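(* Let $\lambda_0\in(0,\lambda_{\max}]$ and $\lambda\in(0,\lambda_0)$, and let $W^*(\lambda)$ be an optimal solution of the MTFL problem with parameter $\lambda$, with $\ell$-th row $(\mathbf{w}^\ell)^*(\lambda)$. Then for every $\ell\in\{1,\ldots,d\}$, $$s_\ell(\lambda,\lambda_0)<1\ \Longrightarrow\ (\mathbf{w}^\ell)^*(\lambda)=0,$$ where $s_\ell(\lambda,\lambda_0)=\max_{\theta\in\mathbf{\Theta}(\lambda,\lambda_0)}g_\ell(\theta)$.
   Context: Let $T,d,N_1,\ldots,N_T$ be positive integers and $N=\sum_{t=1}^T N_t$. For $t=1,\ldots,T$ let $X_t\in\mathbb{R}^{N_t\times d}$ be a data matrix with $\ell$-th column $\mathbf{x}_\ell^{(t)}\in\mathbb{R}^{N_t}$, and let $\mathbf{y}_t\in\mathbb{R}^{N_t}$. Vectors $\theta\in\mathbb{R}^N$ are partitioned into blocks $\theta=(\theta_1,\ldots,\theta_T)$ with $\theta_t\in\mathbb{R}^{N_t}$, and $\mathbf{y}=(\mathbf{y}_1,\ldots,\mathbf{y}_T)\in\mathbb{R}^N$. $\|\cdot\|$ is the Euclidean norm. The MTFL (multi-task feature learning) problem with parameter $\lambda>0$ is $$\min_{W\in\mathbb{R}^{d\times T}}\ \sum_{t=1}^T\tfrac12\|\mathbf{y}_t-X_t\mathbf{w}_t\|^2+\lambda\sum_{\ell=1}^d\|\mathbf{w}^\ell\|,$$ where $\mathbf{w}_t$ is the $t$-th column and $\mathbf{w}^\ell$ the $\ell$-th row of $W$. For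 $\ell=1,\ldots,d$ let $g_\ell(\theta)=\sum_{t=1}^T\langle\mathbf{x}_\ell^{(t)},\theta_t\rangle^2$ on $\mathbb{R}^N$. Let $$\mathcal{F}=\{\theta\in\mathbb{R}^N:\ g_\ell(\theta)\le1,\ \ell=1,\ldots,d\},\qquad \lambda_{\max}=\max_{\ell}\sqrt{g_\ell(\mathbf{y})}.$$ For $\lambda>0$ let $\theta^*(\lambda)=\mathrm{P}_{\mathcal{F}}(\mathbf{y}/\lambda)$ be the Euclidean projection of $\mathbf{y}/\lambda$ onto $\mathcal{F}$ (the dual optimal solution). Fix $\ell_*\in\operatorname{argmax}_\ell g_\ell(\mathbf{y})$. For $0<\lambda<\lambda_0\le\lambda_{\max}$ define $$\mathbf{n}(\lambda_0)=\begin{cases}\mathbf{y}/\lambda_0-\theta^*(\lambda_0), & \lambda_0<\lambda_{\max},\\ \nabla g_{\ell_*}(\mathbf{y}/\lambda_{\max}), & \lambda_0=\lambda_{\max},\end{cases}\qquad \mathbf{r}(\lambda,\lambda_0)=\frac{\mathbf{y}}{\lambda}-\theta^*(\lambda_0),$$ $$\mathbf{r}^{\perp}(\lambda,\lambda_0)=\mathbf{r}(\lambda,\lambda_0)-\frac{\langle\mathbf{n}(\lambda_0),\mathbf{r}(\lambda,\lambda_0)\rangle}{\|\mathbf{n}(\lambda_0)\|^2}\mathbf{n}(\lambda_0),\qquad \mathbf{o}(\lambda,\lambda_0)=\theta^*(\lambda_0)+\tfrac12\mathbf{r}^{\perp}(\lambda,\lambda_0),$$ $$\mathbf{\Theta}(\lambda,\lambda_0)=\left\{\theta\in\mathbb{R}^N:\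 \|\theta-\mathbf{o}(\lambda,\lambda_0)\|\le\tfrac12\|\mathbf{r}^{\perp}(\lambda,\lambda_0)\|\right\}.$$ *)

theory Defs
  imports "HOL-Analysis.Analysis"
begin

text \<open>
  The types \<open>'t\<close>, \<open>'d\<close>, \<open>'n\<close> index the \<open>T\<close> tasks, the \<open>d\<close> features and all \<open>N\<close> samples.
  The map \<open>task :: 'n \<Rightarrow> 't\<close> assigns to each sample its task, so \<open>N\<^sub>t\<close> is the number of \<open>i\<close> with
  \<open>task i = t\<close> and the blocks may have different sizes; all \<open>N\<^sub>t\<close> are positive iff \<open>task\<close> is
  surjective. The data matrices \<open>X\<^sub>t\<close> are stacked into one \<open>N \<times> d\<close> matrix \<open>X\<close>, the vectors \<open>y\<^sub>t\<close>
  into \<open>y \<in> \<real>\<^sup>N\<close>.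

  The space of block \<open>t\<close> is regarded as the coordinate subspace of \<open>\<real>\<^sup>N\<close> of vectors vanishing
  outside block \<open>t\<close>. This preserves inner products and norms. The entries of \<open>v\<close> below
  are reals or, for the data matrix, rows.
\<close>

definition block :: "('n::finite \<Rightarrow> 't) \<Rightarrow> 't \<Rightarrow> 'a::zero ^ 'n \<Rightarrow> 'a ^ 'n" where
  "block task t v = (\<chi> i. if task i = t then v $ i else 0)"

definition mtfl_objective ::
  "('n::finite \<Rightarrow> 't::finite) \<Rightarrow> real ^ 'd::finite ^ 'n \<Rightarrow> real ^ 'n \<Rightarrow> real \<Rightarrow> real ^ 't ^ 'd \<Rightarrow> real"
where
  "mtfl_objective task X y lam W =
     (\<Sum>t\<in>UNIV. 1/2 * (norm (block task t y - block task t X *v column t W))\<^sup>2)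
     + lam * (\<Sum>l\<in>UNIV. norm (row l W))"

definition mtfl_optimal ::
  "('n::finite \<Rightarrow> 't::finite) \<Rightarrow> real ^ 'd::finite ^ 'n \<Rightarrow> real ^ 'n \<Rightarrow> real \<Rightarrow> real ^ 't ^ 'd \<Rightarrow> bool"
where
  "mtfl_optimal task X y lam W \<longleftrightarrow> is_arg_min (mtfl_objective task X y lam) (\<lambda>_. True) W"

definition g :: "('n::finite \<Rightarrow> 't::finite) \<Rightarrow> real ^ 'd::finite ^ 'n \<Rightarrow> 'd \<Rightarrow> real ^ 'n \<Rightarrow> real" where
  "g task X l \<theta> = (\<Sum>t\<in>UNIV. (column l (block task t X) \<bullet> block task t \<theta>)\<^sup>2)"

definition dual_feasible :: "('n::finite \<Rightarrow> 't::finite) \<Rightarrow> real ^ 'd::finite ^ 'n \<Rightarrow> (real ^ 'n) set" where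
  "dual_feasible task X = {\<theta>. \<forall>l. g task X l \<theta> \<le> 1}"

definition lambda_max :: "('n::finite \<Rightarrow> 't::finite) \<Rightarrow> real ^ 'd::finite ^ 'n \<Rightarrow> real ^ 'n \<Rightarrow> real" where
  "lambda_max task X y = Max (range (\<lambda>l. sqrt (g task X l y)))"

definition dual_opt ::
  "('n::finite \<Rightarrow> 't::finite) \<Rightarrow> real ^ 'd::finite ^ 'n \<Rightarrow> real ^ 'n \<Rightarrow> real \<Rightarrow> real ^ 'n" where
  "dual_opt task X y lam = closest_point (dual_feasible task X) (y /\<^sub>R lam)"

definition gradient :: "('a::real_inner \<Rightarrow> real) \<Rightarrow> 'a \<Rightarrow> 'a" where
  "gradient f x = (THE D. GDERIV f x :> D)"

text \<open>In the following, \<open>ls\<close> is the chosen maximizer of \<open>\<lambda>l. g task X l y\<close>.\<close>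

definition normal_vec ::
  "('n::finite \<Rightarrow> 't::finite) \<Rightarrow> real ^ 'd::finite ^ 'n \<Rightarrow> real ^ 'n \<Rightarrow> 'd \<Rightarrow> real \<Rightarrow> real ^ 'n" where
  "normal_vec task X y ls lam0 =
     (if lam0 < lambda_max task X y then y /\<^sub>R lam0 - dual_opt task X y lam0
      else gradient (g task X ls) (y /\<^sub>R lambda_max task X y))"

definition r_vec ::
  "('n::finite \<Rightarrow> 't::finite) \<Rightarrow> real ^ 'd::finite ^ 'n \<Rightarrow> real ^ 'n \<Rightarrow> real \<Rightarrow> real \<Rightarrow> real ^ 'n" where
  "r_vec task X y lam lam0 = y /\<^sub>R lam - dual_opt task X y lam0"

definition r_perp ::
  "('n::finite \<Rightarrow> 't::finite) \<Rightarrow> real ^ 'd::finite ^ 'n \<Rightarrow> real ^ 'n \<Rightarrow> 'd \<Rightarrow> real \<Rightarrow> real \<Rightarrow> real ^ 'n" where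
  "r_perp task X y ls lam lam0 =
     r_vec task X y lam lam0
     - ((normal_vec task X y ls lam0 \<bullet> r_vec task X y lam lam0) / (norm (normal_vec task X y ls lam0))\<^sup>2)
         *\<^sub>R normal_vec task X y ls lam0"

definition o_vec ::
  "('n::finite \<Rightarrow> 't::finite) \<Rightarrow> real ^ 'd::finite ^ 'n \<Rightarrow> real ^ 'n \<Rightarrow> 'd \<Rightarrow> real \<Rightarrow> real \<Rightarrow> real ^ 'n" where
  "o_vec task X y ls lam lam0 = dual_opt task X y lam0 + (1/2) *\<^sub>R r_perp task X y ls lam lam0"

definition Theta ::
  "('n::finite \<Rightarrow> 't::finite) \<Rightarrow> real ^ 'd::finite ^ 'n \<Rightarrow> real ^ 'n \<Rightarrow> 'd \<Rightarrow> real \<Rightarrow> real \<Rightarrow> (real ^ 'n) set"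
where
  "Theta task X y ls lam lam0 =
     {\<theta>. norm (\<theta> - o_vec task X y ls lam lam0) \<le> 1/2 * norm (r_perp task X y ls lam lam0)}"

text \<open>The supremum is a maximum, see \<open>s_score_attained\<close> below.\<close>

definition s_score ::
  "('n::finite \<Rightarrow> 't::finite) \<Rightarrow> real ^ 'd::finite ^ 'n \<Rightarrow> real ^ 'n \<Rightarrow> 'd \<Rightarrow> 'd \<Rightarrow> real \<Rightarrow> real \<Rightarrow> real"
where
  "s_score task X y ls l lam lam0 = (SUP \<theta>\<in>Theta task X y ls lam lam0. g task X l \<theta>)"

lemma inner_block: "column l (block task t X) \<bullet> block task t \<theta> = column l (block task t X) \<bullet> \<theta>"
  unfolding inner_vec_def column_def block_def by (intro sum.cong) auto

lemma continuous_on_g: "continuous_on S (g task X l)"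
proof -
  have "continuous_on S (\<lambda>\<theta>. g task X l \<theta>)"
    unfolding g_def inner_block by (intro continuous_intros)
  then show ?thesis by simp
qed

lemma s_score_attained:
  obtains \<theta> where "\<theta> \<in> Theta task X y ls lam lam0" "g task X l \<theta> = s_score task X y ls l lam lam0"
    "\<forall>\<eta>\<in>Theta task X y ls lam lam0. g task X l \<eta> \<le> g task X l \<theta>"
proof -
  let ?S = "Theta task X y ls lam lam0"
  have S: "?S = cball (o_vec task X y ls lam lam0) (1/2 * norm (r_perp task X y ls lam lam0))"
    by (auto simp: Theta_def dist_norm norm_minus_commute)
  have "compact ?S" "?S \<noteq> {}" unfolding S by auto
  then obtain \<theta> where \<theta>: "\<theta> \<in> ?S" "\<forall>\<eta>\<in>?S. g task X l \<eta> \<le> g task X l \<theta>"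
    using continuous_attains_sup[OF _ _ continuous_on_g] by metis
  have "s_score task X y ls l lam lam0 = g task X l \<theta>"
    unfolding s_score_def using \<theta> by (intro cSup_eq_maximum) auto
  with \<theta> that show ?thesis by simp
qed

lemma gradient_eqI:
  assumes "GDERIV f x :> D"
  shows "gradient f x = D"
proof -
  have "E = D" if "GDERIV f x :> E" for E
  proof -
    have "(\<lambda>h. h \<bullet> E) = (\<lambda>h. h \<bullet> D)"
      using assms that has_derivative_unique unfolding gderiv_def by blast
    then show "E = D" using vector_eq_ldot[of E D] by (simp add: fun_eq_iff)
  qed
  with assms show ?thesis
    unfolding gradient_def by (intro the_equality[where P = "\<lambda>D. GDERIV f x :> D"])
qed

lemma gradient_g:
  "gradient (g task X l) \<theta> =
     (\<Sum>t\<in>UNIV. (2 * (column l (block task t X) \<bullet> \<theta>)) *\<^sub>R column l (block task t X))"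
proof (rule gradient_eqI)
  let ?c = "\<lambda>t. column l (block task t X)"
  have "((\<lambda>\<eta>. (?c t \<bullet> \<eta>)\<^sup>2) has_derivative (\<lambda>h. h \<bullet> ((2 * (?c t \<bullet> \<theta>)) *\<^sub>R ?c t))) (at \<theta>)" for t
    unfolding power2_eq_square
    by (rule has_derivative_eq_rhs[OF has_derivative_mult[OF
          has_derivative_inner_right[OF has_derivative_ident]
          has_derivative_inner_right[OF has_derivative_ident]]])
       (simp add: fun_eq_iff inner_commute)
  then have "((\<lambda>\<eta>. \<Sum>t\<in>UNIV. (?c t \<bullet> \<eta>)\<^sup>2) has_derivative
      (\<lambda>h. \<Sum>t\<in>UNIV. h \<bullet> ((2 * (?c t \<bullet> \<theta>)) *\<^sub>R ?c t))) (at \<theta>)"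
    by (intro has_derivative_sum)
  moreover have "g task X l = (\<lambda>\<eta>. \<Sum>t\<in>UNIV. (?c t \<bullet> \<eta>)\<^sup>2)"
    by (simp add: g_def inner_block fun_eq_iff)
  ultimately show "GDERIV (g task X l) \<theta> :> (\<Sum>t\<in>UNIV. (2 * (?c t \<bullet> \<theta>)) *\<^sub>R ?c t)"
    unfolding gderiv_def by (simp only: inner_sum_right)
qed

end

theory Submission imports Defs
begin

text \<open>
  Write \<open>m\<^sub>l(\<theta>) \<in> \<real>\<^sup>T\<close> for the vector of the correlations of \<open>\<theta>\<close> with the \<open>l\<close>-th columns, so that
  \<open>g\<^sub>l = \<parallel>m\<^sub>l\<parallel>\<^sup>2\<close>, and let \<open>\<rho>\<close> be the residual of an optimal \<open>W\<close>. Perturbing only row \<open>l\<close> of \<open>W\<close> gives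
  \<open>\<parallel>m\<^sub>l(\<rho>)\<parallel> \<le> \<lambda>\<close> and \<open>\<lambda> \<parallel>w\<^sup>l\<parallel> \<le> \<langle>m\<^sub>l(\<rho>), w\<^sup>l\<rangle>\<close>. Hence \<open>\<rho>/\<lambda>\<close> satisfies the variational inequality
  characterizing \<open>\<theta>\<^sup>*(\<lambda>)\<close>, and \<open>g\<^sub>l(\<theta>\<^sup>*(\<lambda>)) < 1\<close> forces \<open>w\<^sup>l = 0\<close>.

  It remains to see that \<open>q = \<theta>\<^sup>*(\<lambda>)\<close> lies in the ball \<open>\<Theta>(\<lambda>, \<lambda>\<^sub>0)\<close>, that is,
  \<open>\<parallel>q - p\<parallel>\<^sup>2 \<le> \<langle>q - p, r\<^sup>\<bottom>\<rangle>\<close> for \<open>p = \<theta>\<^sup>*(\<lambda>\<^sub>0)\<close>. The variational inequality at \<open>q\<close> gives this bound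
  with \<open>r\<close> in place of \<open>r\<^sup>\<bottom>\<close>, and passing to \<open>r\<^sup>\<bottom>\<close> only increases the right-hand side, because
  \<open>n\<close> is normal to the feasible set at \<open>p\<close> and \<open>\<langle>n, r\<rangle> \<ge> 0\<close>.
\<close>

section \<open>Correlations, fitted values and the stacked objective\<close>

definition corr :: "('n::finite \<Rightarrow> 't::finite) \<Rightarrow> real ^ 'd::finite ^ 'n \<Rightarrow> 'd \<Rightarrow> real ^ 'n \<Rightarrow> real ^ 't"
  where "corr task X l \<theta> = (\<chi> t. column l (block task t X) \<bullet> \<theta>)"

text \<open>Sample \<open>i\<close> uses the weights of its own task, so the residuals of all tasks
  form the single vector \<open>y - fit task X W\<close>.\<close>

definition fit :: "('n::finite \<Rightarrow> 't::finite) \<Rightarrow> real ^ 'd::finite ^ 'n \<Rightarrow> real ^ 't ^ 'd \<Rightarrow> real ^ 'n"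
  where "fit task X W = (\<chi> i. \<Sum>l\<in>UNIV. X $ i $ l * W $ l $ task i)"

lemma linear_corr: "linear (corr task X l)"
  by (rule linearI) (simp_all add: corr_def vec_eq_iff inner_add_right)

lemma linear_fit: "linear (fit task X)"
  by (rule linearI)
     (simp_all add: fit_def vec_eq_iff sum.distrib algebra_simps sum_distrib_left)

lemma norm_corr_sq: "(norm (corr task X l \<theta>))\<^sup>2 = g task X l \<theta>"
  unfolding power2_norm_eq_inner inner_vec_def[of "corr task X l \<theta>"]
  by (simp add: g_def inner_block corr_def power2_eq_square)

lemma corr_nth: "corr task X l \<theta> $ t = (\<Sum>i\<in>UNIV. if task i = t then X $ i $ l * \<theta> $ i else 0)"
  unfolding corr_def inner_vec_def column_def block_def by (auto intro!: sum.cong)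

text \<open>\<open>fit\<close> is adjoint to taking all correlations: for each sample only the task
  containing it contributes.\<close>

lemma inner_fit: "\<theta> \<bullet> fit task X W = (\<Sum>l\<in>UNIV. corr task X l \<theta> \<bullet> row l W)"
proof -
  have "corr task X l \<theta> \<bullet> row l W = (\<Sum>i\<in>UNIV. \<theta> $ i * (X $ i $ l * W $ l $ task i))" for l
  proof -
    have "corr task X l \<theta> \<bullet> row l W
        = (\<Sum>t\<in>UNIV. \<Sum>i\<in>UNIV. if task i = t then X $ i $ l * \<theta> $ i * W $ l $ t else 0)"
      by (auto simp: inner_vec_def corr_nth row_def sum_distrib_right intro!: sum.cong)
    also have "\<dots> = (\<Sum>i\<in>UNIV. \<Sum>t\<in>UNIV. if task i = t then X $ i $ l * \<theta> $ i * W $ l $ t else 0)"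
      by (rule sum.swap)
    finally show ?thesis by (simp add: mult_ac)
  qed
  moreover have "\<theta> \<bullet> fit task X W = (\<Sum>l\<in>UNIV. \<Sum>i\<in>UNIV. \<theta> $ i * (X $ i $ l * W $ l $ task i))"
    by (subst sum.swap) (simp add: inner_vec_def fit_def sum_distrib_left)
  ultimately show ?thesis by simp
qed

lemma sum_norm_block_sq: "(\<Sum>t\<in>UNIV. (norm (block task t v))\<^sup>2) = (norm v)\<^sup>2"
  for task :: "'n::finite \<Rightarrow> 't::finite" and v :: "real ^ 'n"
proof -
  have "(\<Sum>t\<in>UNIV. (norm (block task t v))\<^sup>2)
      = (\<Sum>t\<in>UNIV. \<Sum>i\<in>UNIV. if task i = t then v $ i * v $ i else 0)"
    by (auto simp: power2_norm_eq_inner inner_vec_def block_def intro!: sum.cong)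
  also have "\<dots> = (\<Sum>i\<in>UNIV. \<Sum>t\<in>UNIV. if task i = t then v $ i * v $ i else 0)"
    by (rule sum.swap)
  finally show ?thesis by (simp add: power2_norm_eq_inner inner_vec_def)
qed

lemma block_residual:
  "block task t y - block task t X *v column t W = block task t (y - fit task X W)"
  by (auto simp: vec_eq_iff block_def fit_def matrix_vector_mult_def column_def)

lemma mtfl_objective_eq:
  "mtfl_objective task X y lam W
     = 1/2 * (norm (y - fit task X W))\<^sup>2 + lam * (\<Sum>l\<in>UNIV. norm (row l W))"
  unfolding mtfl_objective_def block_residual
  by (simp only: sum_distrib_left[symmetric] sum_norm_block_sq)

section \<open>The dual feasible set and projections\<close>

lemma dual_feasible_eq: "dual_feasible task X = {\<theta>. \<forall>l. norm (corr task X l \<theta>) \<le> 1}"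
  by (simp add: dual_feasible_def norm_corr_sq[symmetric] abs_square_le_1)

lemma zero_in_dual_feasible: "0 \<in> dual_feasible task X"
  by (simp add: dual_feasible_eq linear_0[OF linear_corr])

lemma dual_feasible_INT: "dual_feasible task X = (\<Inter>l. corr task X l -` cball 0 1)"
  by (auto simp: dual_feasible_eq)

lemma closed_dual_feasible: "closed (dual_feasible task X)"
  unfolding dual_feasible_INT
  by (intro closed_INT ballI continuous_closed_vimage closed_cball
      linear_continuous_at linear_conv_bounded_linear[THEN iffD1] linear_corr)

lemma convex_dual_feasible: "convex (dual_feasible task X)"
  unfolding dual_feasible_INT
  by (intro convex_INT convex_linear_vimage linear_corr convex_cball)

text \<open>Adding the variational inequalities at \<open>p\<close> and at the projection bounds the
  squared distance of the two points by 0.\<close>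

lemma closest_point_eqI:
  fixes a p :: "'a::euclidean_space"
  assumes "convex S" "closed S" "p \<in> S" "\<And>z. z \<in> S \<Longrightarrow> (a - p) \<bullet> (z - p) \<le> 0"
  shows "closest_point S a = p"
proof -
  let ?q = "closest_point S a"
  have "(a - ?q) \<bullet> (p - ?q) \<le> 0"
    using assms closest_point_dot by blast
  moreover have "(a - p) \<bullet> (?q - p) \<le> 0"
    using assms closest_point_in_set by blast
  ultimately have "(?q - p) \<bullet> (?q - p) \<le> 0"
    by (simp add: algebra_simps inner_commute)
  then show ?thesis
    by (metis inner_ge_zero order_antisym inner_eq_zero_iff right_minus_eq)
qed

section \<open>First-order conditions for the primal problem\<close>

text \<open>Divide by \<open>s\<close> and let \<open>s\<close> tend to 0 from the right. This
  replaces directional derivatives of the nonsmooth objective.\<close>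

lemma le_if_le_add_small:
  fixes a b c :: real
  assumes "\<And>s. 0 < s \<Longrightarrow> s < 1 \<Longrightarrow> s * a \<le> s * b + s\<^sup>2 * c"
  shows "a \<le> b"
proof (rule tendsto_lowerbound[where F = "at_right 0"])
  show "((\<lambda>s. b + s * c) \<longlongrightarrow> b) (at_right 0)"
    by (auto intro!: tendsto_eq_intros)
  have "a \<le> b + s * c" if "s \<in> {0<..<1}" for s
  proof -
    have "s * a \<le> s * (b + s * c)"
      using assms[of s] that by (simp add: power2_eq_square algebra_simps)
    with that show ?thesis by simp
  qed
  then show "\<forall>\<^sub>F s in at_right 0. a \<le> b + s * c"
    using eventually_at_right_real[of 0 1] by (auto elim: eventually_mono)
qed simp

text \<open>Moving row \<open>l\<close> along \<open>v\<close> lowers the loss at the rate on the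
  left, up to a quadratic term; \<open>k\<close> bounds the slope of the row norm.\<close>

lemma mtfl_optimal_first_order:
  assumes opt: "mtfl_optimal task X y lam W" and "0 \<le> lam"
    and decr: "\<And>s. 0 < s \<Longrightarrow> s < 1 \<Longrightarrow> norm (row l W + s *\<^sub>R v) \<le> norm (row l W) + s * k"
  shows "corr task X l (y - fit task X W) \<bullet> v \<le> lam * k"
proof (rule le_if_le_add_small)
  fix s :: real assume s: "0 < s" "s < 1"
  define V where "V = (\<chi> j. if j = l then v else 0)"
  let ?R = "y - fit task X W"
  have row: "row j (W + s *\<^sub>R V) = (if j = l then row l W + s *\<^sub>R v else row j W)" for j
    by (simp add: row_def V_def vec_eq_iff)
  have "(\<Sum>j\<in>UNIV. norm (row j (W + s *\<^sub>R V)))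
      = (\<Sum>j\<in>UNIV. norm (row j W)) + (norm (row l W + s *\<^sub>R v) - norm (row l W))"
    unfolding row by (simp add: sum.remove[of UNIV l])
  also have "\<dots> \<le> (\<Sum>j\<in>UNIV. norm (row j W)) + s * k"
    using decr[OF s] by simp
  finally have 1: "lam * (\<Sum>j\<in>UNIV. norm (row j (W + s *\<^sub>R V)))
      \<le> lam * (\<Sum>j\<in>UNIV. norm (row j W)) + s * (lam * k)"
    using mult_left_mono[OF _ \<open>0 \<le> lam\<close>] by (fastforce simp: algebra_simps)
  have "corr task X j ?R \<bullet> row j V = (if j = l then corr task X l ?R \<bullet> v else 0)" for j
    by (simp add: row_def V_def inner_vec_def)
  then have "?R \<bullet> fit task X V = corr task X l ?R \<bullet> v"
    by (simp add: inner_fit)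
  moreover have "y - fit task X (W + s *\<^sub>R V) = ?R - s *\<^sub>R fit task X V"
    by (simp add: linear_add[OF linear_fit] linear_cmul[OF linear_fit])
  moreover have "(norm (?R - s *\<^sub>R fit task X V))\<^sup>2
      = (norm ?R)\<^sup>2 - 2 * s * (?R \<bullet> fit task X V) + s\<^sup>2 * (norm (fit task X V))\<^sup>2"
    using dot_norm_neg[of ?R "s *\<^sub>R fit task X V"] by (simp add: power_mult_distrib field_simps)
  ultimately have 2: "(norm (y - fit task X (W + s *\<^sub>R V)))\<^sup>2
      = (norm ?R)\<^sup>2 - 2 * s * (corr task X l ?R \<bullet> v) + s\<^sup>2 * (norm (fit task X V))\<^sup>2"
    by (simp only:)
  have "mtfl_objective task X y lam W \<le> mtfl_objective task X y lam (W + s *\<^sub>R V)"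
    using opt by (auto simp: mtfl_optimal_def is_arg_min_def not_less)
  then show "s * (corr task X l ?R \<bullet> v) \<le> s * (lam * k) + s\<^sup>2 * (1/2 * (norm (fit task X V))\<^sup>2)"
    using 1 unfolding mtfl_objective_eq 2 by (simp add: algebra_simps)
qed

text \<open>The test direction is the correlation vector itself; one factor of its norm then
  cancels.\<close>

lemma mtfl_optimal_corr_le:
  assumes "mtfl_optimal task X y lam W" and "0 \<le> lam"
  shows "norm (corr task X l (y - fit task X W)) \<le> lam"
proof -
  let ?m = "corr task X l (y - fit task X W)"
  have "norm (row l W + s *\<^sub>R ?m) \<le> norm (row l W) + s * norm ?m" if "0 < s" for s
    using norm_triangle_ineq[of "row l W" "s *\<^sub>R ?m"] that by simp
  then have "norm ?m * norm ?m \<le> lam * norm ?m"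
    using mtfl_optimal_first_order[OF assms, of l ?m "norm ?m"] by (simp add: dot_square_norm power2_eq_square)
  with \<open>0 \<le> lam\<close> show ?thesis
    by (cases "norm ?m = 0") (auto simp: mult_le_cancel_right)
qed

text \<open>The test direction is \<open>- row l W\<close>: shrinking the row lowers its norm
  linearly for \<open>s < 1\<close>.\<close>

lemma mtfl_optimal_corr_ge:
  assumes "mtfl_optimal task X y lam W" and "0 \<le> lam"
  shows "lam * norm (row l W) \<le> corr task X l (y - fit task X W) \<bullet> row l W"
proof -
  have "norm (row l W + s *\<^sub>R - row l W) \<le> norm (row l W) + s * - norm (row l W)"
    if "0 < s" "s < 1" for s
  proof -
    have "row l W + s *\<^sub>R - row l W = (1 - s) *\<^sub>R row l W" by (simp add: algebra_simps)
    then have "norm (row l W + s *\<^sub>R - row l W) = (1 - s) * norm (row l W)"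
      using that by simp
    then show ?thesis by (simp add: algebra_simps)
  qed
  then show ?thesis
    using mtfl_optimal_first_order[OF assms, of l "- row l W" "- norm (row l W)"] by simp
qed

section \<open>The dual optimum as scaled residual\<close>

lemma dual_opt_eq_residual:
  assumes opt: "mtfl_optimal task X y lam W" and "0 < lam"
  shows "dual_opt task X y lam = (y - fit task X W) /\<^sub>R lam"
  unfolding dual_opt_def
proof (rule closest_point_eqI[OF convex_dual_feasible closed_dual_feasible])
  let ?\<theta> = "(y - fit task X W) /\<^sub>R lam"
  show "?\<theta> \<in> dual_feasible task X"
    using mtfl_optimal_corr_le[OF opt] \<open>0 < lam\<close>
    by (simp add: dual_feasible_eq linear_cmul[OF linear_corr] divide_inverse_commute[symmetric]
        del: scaleR_diff_right)
  fix z assume z: "z \<in> dual_feasible task X"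
  \<comment> \<open>The scaled residual maximizes \<open>z \<bullet> fit task X W\<close> over
    feasible \<open>z\<close>: Cauchy-Schwarz bounds the value by the sum of row norms, which the
    residual reaches.\<close>
  have "z \<bullet> fit task X W \<le> (\<Sum>l\<in>UNIV. norm (row l W))"
    unfolding inner_fit
  proof (rule sum_mono)
    fix l
    have "corr task X l z \<bullet> row l W \<le> norm (corr task X l z) * norm (row l W)"
      by (rule norm_cauchy_schwarz)
    also have "\<dots> \<le> norm (row l W)"
      using z by (simp add: dual_feasible_eq mult_left_le_one_le)
    finally show "corr task X l z \<bullet> row l W \<le> norm (row l W)" .
  qed
  also have "\<dots> \<le> ?\<theta> \<bullet> fit task X W"
    unfolding inner_fit using mtfl_optimal_corr_ge[OF opt] \<open>0 < lam\<close>
    by (intro sum_mono) (simp add: linear_cmul[OF linear_corr] pos_le_divide_eq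
        divide_inverse_commute[symmetric] mult.commute del: scaleR_diff_right)
  finally have "fit task X W \<bullet> (z - ?\<theta>) \<le> 0"
    by (simp only: inner_diff_right inner_commute)
  moreover have "y /\<^sub>R lam - ?\<theta> = fit task X W /\<^sub>R lam"
    by (simp add: algebra_simps)
  ultimately show "(y /\<^sub>R lam - ?\<theta>) \<bullet> (z - ?\<theta>) \<le> 0"
    using \<open>0 < lam\<close> by (simp add: field_simps)
qed

lemma row_eq_0_if_g_less_1:
  assumes opt: "mtfl_optimal task X y lam W" and "0 < lam"
    and "g task X l (dual_opt task X y lam) < 1"
  shows "row l W = 0"
proof (rule ccontr)
  assume "row l W \<noteq> 0"
  let ?m = "corr task X l (y - fit task X W)"
  have "norm (corr task X l (dual_opt task X y lam)) < 1"
    using assms(3) by (simp add: norm_corr_sq[symmetric] abs_square_less_1)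
  then have "norm ?m < lam"
    using \<open>0 < lam\<close>
    by (simp add: dual_opt_eq_residual[OF opt] linear_cmul[OF linear_corr]
        divide_inverse_commute[symmetric] del: scaleR_diff_right)
  then have "norm ?m * norm (row l W) < lam * norm (row l W)"
    using \<open>row l W \<noteq> 0\<close> by simp
  then show False
    using mtfl_optimal_corr_ge[OF opt, of l] norm_cauchy_schwarz[of ?m "row l W"] \<open>0 < lam\<close> by simp
qed

section \<open>Dual optima and normals to the feasible set\<close>

lemma dual_opt_in: "dual_opt task X y lam \<in> dual_feasible task X"
  unfolding dual_opt_def
  using closest_point_in_set[OF closed_dual_feasible] zero_in_dual_feasible by blast

lemma dual_opt_dot:
  "z \<in> dual_feasible task X
    \<Longrightarrow> (y /\<^sub>R lam - dual_opt task X y lam) \<bullet> (z - dual_opt task X y lam) \<le> 0"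
  unfolding dual_opt_def
  by (rule closest_point_dot[OF convex_dual_feasible closed_dual_feasible])

lemma inner_gradient_g:
  "gradient (g task X l) \<theta> \<bullet> z = 2 * (corr task X l \<theta> \<bullet> corr task X l z)"
  unfolding inner_vec_def[of "corr task X l \<theta>"]
  by (simp add: gradient_g inner_sum_left corr_def sum_distrib_left mult_ac)

text \<open>Convexity of \<open>g task X l\<close>: the gap between the two sides is the squared
  distance of the correlation vectors.\<close>

lemma gradient_g_le: "gradient (g task X l) \<theta> \<bullet> (z - \<theta>) \<le> g task X l z - g task X l \<theta>"
proof -
  have "0 \<le> (norm (corr task X l z - corr task X l \<theta>))\<^sup>2" by simp
  then show ?thesis
    unfolding inner_gradient_g norm_corr_sq[symmetric] linear_diff[OF linear_corr]
    by (simp add: power2_norm_eq_inner inner_diff_left inner_diff_right inner_commute)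
qed

lemma g_scaleR: "g task X l (c *\<^sub>R \<theta>) = c\<^sup>2 * g task X l \<theta>"
  by (simp add: norm_corr_sq[symmetric] linear_cmul[OF linear_corr] power_mult_distrib)

lemma g_le_lambda_max_sq: "g task X l y \<le> (lambda_max task X y)\<^sup>2"
proof -
  have "sqrt (g task X l y) \<le> lambda_max task X y"
    unfolding lambda_max_def by (intro Max_ge) auto
  then show ?thesis by (simp add: sqrt_le_D)
qed

lemma g_argmax_eq_lambda_max_sq:
  assumes "is_arg_max (\<lambda>k. g task X k y) (\<lambda>_. True) ls"
  shows "g task X ls y = (lambda_max task X y)\<^sup>2"
proof -
  have "lambda_max task X y = sqrt (g task X ls y)"
    unfolding lambda_max_def using assms
    by (intro Max_eqI) (auto simp: is_arg_max_def not_less)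
  then show ?thesis by (simp add: norm_corr_sq[symmetric])
qed

lemma dual_opt_lambda_max:
  assumes "0 < lambda_max task X y"
  shows "dual_opt task X y (lambda_max task X y) = y /\<^sub>R lambda_max task X y"
proof -
  have "y /\<^sub>R lambda_max task X y \<in> dual_feasible task X"
    using g_le_lambda_max_sq[of task X _ y] assms
    by (simp add: dual_feasible_def g_scaleR field_simps)
  then show ?thesis by (simp add: dual_opt_def closest_point_self)
qed

lemma normal_vec_normal:
  assumes "is_arg_max (\<lambda>k. g task X k y) (\<lambda>_. True) ls"
    and "0 < lam0" "lam0 \<le> lambda_max task X y" and z: "z \<in> dual_feasible task X"
  shows "normal_vec task X y ls lam0 \<bullet> (z - dual_opt task X y lam0) \<le> 0"
proof (cases "lam0 < lambda_max task X y")
  case True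
  then show ?thesis using dual_opt_dot[OF z] by (simp add: normal_vec_def)
next
  case False
  then have lam0: "lam0 = lambda_max task X y" using assms by simp
  \<comment> \<open>At \<open>lambda_max\<close> the constraint of \<open>ls\<close> is active, so
    by convexity its gradient is normal to the feasible set.\<close>
  have "g task X ls (y /\<^sub>R lambda_max task X y) = 1"
    using assms(2) lam0 by (simp add: g_scaleR g_argmax_eq_lambda_max_sq[OF assms(1)] field_simps)
  moreover have "g task X ls z \<le> 1" using z by (simp add: dual_feasible_def)
  ultimately show ?thesis
    using gradient_g_le[of task X ls "y /\<^sub>R lambda_max task X y" z] assms(2) lam0
    by (simp add: normal_vec_def dual_opt_lambda_max)
qed

lemma normal_vec_inner_y:
  fixes y :: "real ^ 'n::finite"
  assumes "0 < lam0" "lam0 \<le> lambda_max task X y"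
  shows "0 \<le> normal_vec task X y ls lam0 \<bullet> y"
proof (cases "lam0 < lambda_max task X y")
  case True
  let ?p = "dual_opt task X y lam0"
  let ?n = "y /\<^sub>R lam0 - ?p"
  \<comment> \<open>Test the variational inequality with \<open>z = 0\<close>; moreover
    \<open>?n + ?p\<close> is \<open>y /\<^sub>R lam0\<close>.\<close>
  have "0 \<le> ?n \<bullet> ?p" using dual_opt_dot[OF zero_in_dual_feasible, where y = y and lam = lam0] by simp
  then have "0 \<le> ?n \<bullet> (?n + ?p)" by (simp only: inner_add_right inner_ge_zero add_nonneg_nonneg)
  then show ?thesis
    using True assms(1) by (simp add: normal_vec_def zero_le_mult_iff)
next
  case False
  then show ?thesis
    using assms by (simp add: normal_vec_def inner_gradient_g linear_cmul[OF linear_corr])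
qed

lemma normal_vec_inner_r_vec:
  assumes "0 < lam0" "lam0 \<le> lambda_max task X y" "0 < lam" "lam < lam0"
  shows "0 \<le> normal_vec task X y ls lam0 \<bullet> r_vec task X y lam lam0"
proof -
  let ?n = "normal_vec task X y ls lam0"
  \<comment> \<open>The first summand is the normal vector itself or, at \<open>lambda_max\<close>,
    zero; the second is a positive multiple of \<open>y\<close>.\<close>
  have "r_vec task X y lam lam0
      = (y /\<^sub>R lam0 - dual_opt task X y lam0) + (1 / lam - 1 / lam0) *\<^sub>R y"
    by (simp add: r_vec_def algebra_simps inverse_eq_divide)
  moreover have "0 \<le> (1 / lam - 1 / lam0) * (?n \<bullet> y)"
    using assms by (intro mult_nonneg_nonneg normal_vec_inner_y) (simp_all add: frac_le)
  moreover have "0 \<le> ?n \<bullet> (y /\<^sub>R lam0 - dual_opt task X y lam0)"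
  proof (cases "lam0 < lambda_max task X y")
    case True
    then show ?thesis by (simp add: normal_vec_def)
  next
    case False
    then have "lam0 = lambda_max task X y" using assms by simp
    then show ?thesis using assms by (simp add: dual_opt_lambda_max)
  qed
  ultimately show ?thesis by (simp add: inner_add_right)
qed

section \<open>The ball containing the dual optimum\<close>

text \<open>The ball has the segment from 0 to \<open>b\<close> as a diameter (Thales): both sides
  say \<open>a \<bullet> (a - b) \<le> 0\<close>.\<close>

lemma norm_diff_half_le_iff:
  fixes a b :: "'a::real_inner"
  shows "norm (a - (1/2) *\<^sub>R b) \<le> 1/2 * norm b \<longleftrightarrow> (norm a)\<^sup>2 \<le> a \<bullet> b"
proof -
  have "norm (a - (1/2) *\<^sub>R b) \<le> 1/2 * norm b
      \<longleftrightarrow> (norm (a - (1/2) *\<^sub>R b))\<^sup>2 \<le> (1/2 * norm b)\<^sup>2"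
    by (simp add: abs_le_square_iff[symmetric])
  also have "\<dots> \<longleftrightarrow> (norm a)\<^sup>2 \<le> a \<bullet> b"
    unfolding power_mult_distrib power2_norm_eq_inner
    by (simp add: inner_diff_left inner_diff_right inner_commute power2_eq_square)
  finally show ?thesis .
qed

lemma dual_opt_in_Theta:
  assumes "is_arg_max (\<lambda>k. g task X k y) (\<lambda>_. True) ls"
    and "0 < lam0" "lam0 \<le> lambda_max task X y" "0 < lam" "lam < lam0"
  shows "dual_opt task X y lam \<in> Theta task X y ls lam lam0"
proof -
  let ?p = "dual_opt task X y lam0" and ?q = "dual_opt task X y lam"
  let ?n = "normal_vec task X y ls lam0" and ?r = "r_vec task X y lam lam0"
  let ?h = "?q - ?p"
  have "(y /\<^sub>R lam - ?q) \<bullet> (?p - ?q) \<le> 0" by (rule dual_opt_dot[OF dual_opt_in])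
  \<comment> \<open>Here \<open>y /\<^sub>R lam - ?q = ?r - ?h\<close> and
    \<open>?p - ?q = - ?h\<close>.\<close>
  moreover have "(y /\<^sub>R lam - ?q) \<bullet> (?p - ?q) = (norm ?h)\<^sup>2 - ?h \<bullet> ?r"
    by (simp add: r_vec_def power2_norm_eq_inner algebra_simps inner_commute)
  \<comment> \<open>This pairs \<open>?h\<close> with the component of \<open>?r\<close> removed in
    \<open>r_perp\<close>. If \<open>?n\<close> is 0, the quotient is 0 by convention.\<close>
  moreover have "(?n \<bullet> ?r) / (norm ?n)\<^sup>2 * (?n \<bullet> ?h) \<le> 0"
    using assms normal_vec_normal[OF assms(1-3) dual_opt_in] normal_vec_inner_r_vec
    by (intro mult_nonneg_nonpos divide_nonneg_nonneg) auto
  ultimately have "(norm ?h)\<^sup>2 \<le> ?h \<bullet> r_perp task X y ls lam lam0"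
    by (simp add: r_perp_def inner_diff_right inner_commute)
  then show ?thesis
    using norm_diff_half_le_iff[of ?h "r_perp task X y ls lam lam0"]
    by (simp add: Theta_def o_vec_def diff_diff_eq)
qed

theorem theorem8:
  fixes task :: "'n::finite \<Rightarrow> 't::finite"
    and X :: "real ^ 'd::finite ^ 'n"
    and y :: "real ^ 'n"
    and ls l :: 'd
    and lam lam0 :: real
    and W :: "real ^ 't ^ 'd"
  assumes "surj task"
    and "is_arg_max (\<lambda>k. g task X k y) (\<lambda>_. True) ls"
    and "0 < lam0" and "lam0 \<le> lambda_max task X y"
    and "0 < lam" and "lam < lam0"
    and "mtfl_optimal task X y lam W"
    and "s_score task X y ls l lam lam0 < 1"
  shows "row l W = 0"
proof (rule row_eq_0_if_g_less_1[OF assms(7,5)])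
  have "g task X l (dual_opt task X y lam) \<le> s_score task X y ls l lam lam0"
    using s_score_attained[of task X y ls lam lam0 l] dual_opt_in_Theta[OF assms(2-6)] by metis
  with assms(8) show "g task X l (dual_opt task X y lam) < 1" by simp
qed

end
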